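(* For every integer $n\ge 3$, the complete graph $K_n$ has an antimagic orientation.
   Context: An antimagic labeling of a directed graph $D$ with $n$ vertices and $l$ arcs is a bijection $f$ from the arc set of $D$ to $\{1,2,\dots,l\}$ such that the $n$ oriented vertex sums are pairwise distinct, where the oriented vertex sum of a vertex $v$ is the sum of the labels of all arcs entering $v$ minus the sum of the labels of all arcs leaving $v$. An antimagic orientation of an undirected graph $G$ is an orientation of $G$ (a choice of direction for each edge) such that the resulting directed graph admits an antimagic labeling. *)

theory Defs
  imports "Graph_Theory.Graph_Theory"
begin

text \<open>
  An undirected simple graph is a symmetric digraph (locale \<^locale>\<open>graph\<close>): the edge
  $uv$ is represented by the two opposite arcs $(u,v)$ and $(v,u)$. Choosing a direction for
  each edge therefore amounts to keeping exactly one arc of each opposite pair.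
\<close>

definition orientation :: "('a, 'b) pre_digraph \<Rightarrow> ('a, 'b) pre_digraph \<Rightarrow> bool" where
  "orientation D G \<longleftrightarrow> graph G \<and> spanning D G \<and>
     (\<forall>u v. (u, v) \<in> arcs_ends G \<longrightarrow> ((u, v) \<in> arcs_ends D \<longleftrightarrow> (v, u) \<notin> arcs_ends D))"

definition oriented_vertex_sum :: "('a, 'b) pre_digraph \<Rightarrow> ('b \<Rightarrow> nat) \<Rightarrow> 'a \<Rightarrow> int" where
  "oriented_vertex_sum D f v =
     (\<Sum>e\<in>in_arcs D v. int (f e)) - (\<Sum>e\<in>out_arcs D v. int (f e))"

definition antimagic_labeling :: "('a, 'b) pre_digraph \<Rightarrow> ('b \<Rightarrow> nat) \<Rightarrow> bool" where
  "antimagic_labeling D f \<longleftrightarrow>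
     bij_betw f (arcs D) {1..card (arcs D)} \<and> inj_on (oriented_vertex_sum D f) (verts D)"

definition antimagic_orientation :: "('a, 'b) pre_digraph \<Rightarrow> ('a, 'b) pre_digraph \<Rightarrow> bool" where
  "antimagic_orientation D G \<longleftrightarrow> orientation D G \<and> (\<exists>f. antimagic_labeling D f)"

end

theory Submission
  imports Defs
begin

text \<open>
  Number the vertices \<open>0, \<dots>, n - 1\<close> and orient every edge towards its larger end. Label the
  arc from \<open>i\<close> to \<open>j\<close> by \<open>(j choose 2) + (j - i)\<close>, so that the arcs entering \<open>j\<close> get a block of
  \<open>j\<close> consecutive labels, following the block of \<open>j - 1\<close>. The label is increasing in the head and
  decreasing in the tail. Hence passing from a vertex to a larger one, there are more incoming
  arcs with larger labels and fewer outgoing arcs with smaller labels, and so the oriented vertex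
  sum is strictly increasing.
\<close>

definition block_label :: "nat \<Rightarrow> nat \<Rightarrow> nat" where
  "block_label i j = (j choose 2) + (j - i)"

lemma block_label_mono_head: "j \<le> k \<Longrightarrow> block_label i j \<le> block_label i k"
  unfolding block_label_def by (intro add_mono binomial_right_mono) auto

lemma block_label_antimono_tail: "i \<le> k \<Longrightarrow> block_label k j \<le> block_label i j"
  unfolding block_label_def by simp

lemma block_label_pos: "i < j \<Longrightarrow> 0 < block_label i j"
  unfolding block_label_def by simp

text \<open>Induction on \<open>n\<close>: the pairs with second entry \<open>n\<close> take exactly
  the \<open>n\<close> labels that follow \<open>n choose 2\<close>, so the blocks tile the
  interval.\<close>

lemma bij_betw_block_label:
  "bij_betw (\<lambda>(i, j). block_label i j) {(i, j). i < j \<and> j < n} {1..n choose 2}"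
proof (induction n)
  case 0
  then show ?case by (simp add: bij_betw_def)
next
  case (Suc n)
  have choose: "Suc n choose 2 = (n choose 2) + n"
    by (simp add: numeral_2_eq_2)
  have block: "bij_betw (\<lambda>(i, j). block_label i j) ({..<n} \<times> {n})
      {Suc (n choose 2)..Suc n choose 2}"
    \<comment> \<open>The inverse comes from solving \<open>m = (n choose 2) + (n - i)\<close> for
      \<open>i\<close>.\<close>
    by (rule bij_betw_byWitness[where f' = "\<lambda>m. ((n choose 2) + n - m, n)"])
      (auto simp: block_label_def choose)
  have pairs: "{(i, j). i < j \<and> j < Suc n} = {(i, j). i < j \<and> j < n} \<union> {..<n} \<times> {n}"
    by (auto simp: less_Suc_eq)
  have labels: "{1..Suc n choose 2} = {1..n choose 2} \<union> {Suc (n choose 2)..Suc n choose 2}"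
    by (auto simp: choose)
  show ?case
    unfolding pairs labels by (rule bij_betw_combine[OF Suc.IH block]) auto
qed

text \<open>The two sides are the oriented vertex sums of the vertices numbered \<open>u\<close> and
  \<open>v\<close>. Incoming and outgoing parts are compared separately; the outgoing part already
  gives strictness.\<close>

lemma block_label_vertex_sum_less:
  assumes "u < v" "v < n"
  shows "(\<Sum>i<u. int (block_label i u)) - (\<Sum>j\<in>{u<..<n}. int (block_label u j))
       < (\<Sum>i<v. int (block_label i v)) - (\<Sum>j\<in>{v<..<n}. int (block_label v j))"
proof -
  have "(\<Sum>i<u. int (block_label i u)) \<le> (\<Sum>i<u. int (block_label i v))"
    using assms by (intro sum_mono) (simp add: block_label_mono_head)
  also have "\<dots> \<le> (\<Sum>i<v. int (block_label i v))"
    using assms by (intro sum_mono2) auto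
  finally have incoming: "(\<Sum>i<u. int (block_label i u)) \<le> (\<Sum>i<v. int (block_label i v))" .
  have "(\<Sum>j\<in>{v<..<n}. int (block_label v j)) \<le> (\<Sum>j\<in>{v<..<n}. int (block_label u j))"
    using assms by (intro sum_mono) (simp add: block_label_antimono_tail)
  also have "\<dots> < (\<Sum>j\<in>{u<..<n}. int (block_label u j))"
    \<comment> \<open>The index \<open>v\<close> occurs only in the larger range, and its term, the
      label of the arc from \<open>u\<close> to \<open>v\<close>, is positive.\<close>
    using assms by (intro sum_strict_mono2[where b = v]) (auto simp: block_label_pos)
  finally show ?thesis
    using incoming by linarith
qed

theorem theorem5:
  fixes G :: "('a, 'b) pre_digraph" and n :: nat
  assumes "n \<ge> 3" and "complete_digraph n G"
  shows "\<exists>D. antimagic_orientation D G"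
proof -
  interpret graph G
    using assms(2) by (simp add: complete_digraph_def)
  have card: "card (verts G) = n"
    and ends: "arcs_ends G = {(u, v). (u, v) \<in> verts G \<times> verts G \<and> u \<noteq> v}"
    using assms(2) by (simp_all add: complete_digraph_def)
  obtain h where "bij_betw h (verts G) {0..<n}"
    using ex_bij_betw_finite_nat[OF finite_verts] card by blast
  then have h: "bij_betw h (verts G) {..<n}"
    by (simp add: atLeast0LessThan)
  have h_eq: "h u = h v \<longleftrightarrow> u = v" if "u \<in> verts G" "v \<in> verts G" for u v
    using h that by (auto simp: bij_betw_def inj_on_def)
  have h_less: "h u < n" if "u \<in> verts G" for u
    using h that by (auto simp: bij_betw_def)
  define D where "D = G\<lparr>arcs := {e \<in> arcs G. h (tail G e) < h (head G e)}\<rparr>"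
  define f where "f = (\<lambda>e. block_label (h (tail G e)) (h (head G e)))"
  have arcs_D: "arcs D = {e \<in> arcs G. h (tail G e) < h (head G e)}"
    and [simp]: "verts D = verts G" "tail D = tail G" "head D = head G"
    by (simp_all add: D_def)
  \<comment> \<open>Arcs have an abstract type, so they are identified through their ends:
    \<open>G\<close> has no parallel arcs and \<open>h\<close> is injective on vertices.\<close>
  have arc_eqI: "e = e'"
    if "e \<in> arcs G" "e' \<in> arcs G" "h (tail G e) = h (tail G e')" "h (head G e) = h (head G e')"
    for e e'
    using that by (intro no_multi_arcs) (auto simp: arc_to_ends_def h_eq)
  \<comment> \<open>Completeness of \<open>G\<close> supplies an arc for every pair of
    numbers.\<close>
  have arc_ex: "\<exists>e \<in> arcs D. h (tail G e) = i \<and> h (head G e) = j" if "i < j" "j < n" for i j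
  proof -
    from that h obtain u v where uv: "u \<in> verts G" "v \<in> verts G" "h u = i" "h v = j"
      by (metis bij_betw_imp_surj_on imageE lessThan_iff less_trans)
    then have "(u, v) \<in> arcs_ends G"
      using \<open>i < j\<close> by (auto simp: ends)
    then show ?thesis
      using uv \<open>i < j\<close> by (auto simp: arcs_ends_conv arcs_D)
  qed

  have "wf_digraph D"
    by unfold_locales (auto simp: arcs_D)
  then have "spanning D G"
    using wf_digraph by (auto simp: spanning_def subgraph_def compatible_def arcs_D)
  moreover have "(u, v) \<in> arcs_ends D \<longleftrightarrow> (u, v) \<in> arcs_ends G \<and> h u < h v" for u v
    by (auto simp: arcs_ends_conv arcs_D)
  \<comment> \<open>Adjacent vertices are distinct, hence have distinct numbers; so exactly one arc
    of each opposite pair survives in \<open>D\<close>.\<close>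
  moreover have "h u < h v \<longleftrightarrow> \<not> h v < h u" if "(u, v) \<in> arcs_ends G" for u v
    using that h_eq[of u v] by (auto simp: ends)
  ultimately have orientation: "orientation D G"
    using graph_axioms arcs_ends_symmetric[OF sym_arcs] unfolding orientation_def by blast

  have "bij_betw (\<lambda>e. (h (tail G e), h (head G e))) (arcs D) {(i, j). i < j \<and> j < n}"
    unfolding bij_betw_def
  proof
    show "inj_on (\<lambda>e. (h (tail G e), h (head G e))) (arcs D)"
      by (rule inj_onI) (auto simp: arcs_D intro: arc_eqI)
    show "(\<lambda>e. (h (tail G e), h (head G e))) ` arcs D = {(i, j). i < j \<and> j < n}"
      using arc_ex by (fastforce simp: arcs_D h_less)
  qed
  from bij_betw_trans[OF this bij_betw_block_label]
  have "bij_betw f (arcs D) {1..n choose 2}"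
    by (simp add: f_def o_def)
  \<comment> \<open>The bijection \<open>f\<close> itself shows that \<open>D\<close> has
    \<open>n choose 2\<close> arcs.\<close>
  then have bij: "bij_betw f (arcs D) {1..card (arcs D)}"
    using bij_betw_same_card by fastforce

  have vertex_sum: "oriented_vertex_sum D f v =
      (\<Sum>i<h v. int (block_label i (h v))) - (\<Sum>j\<in>{h v<..<n}. int (block_label (h v) j))"
    if v: "v \<in> verts G" for v
  proof -
    have "bij_betw (h \<circ> tail G) (in_arcs D v) {..<h v}"
      unfolding bij_betw_def
    proof
      show "inj_on (h \<circ> tail G) (in_arcs D v)"
        by (rule inj_onI) (auto simp: arcs_D intro: arc_eqI)
      show "(h \<circ> tail G) ` in_arcs D v = {..<h v}"
      proof
        show "{..<h v} \<subseteq> (h \<circ> tail G) ` in_arcs D v"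
        proof
          fix i assume "i \<in> {..<h v}"
          then obtain e where e: "e \<in> arcs D" "h (tail G e) = i" "h (head G e) = h v"
            using arc_ex h_less[OF v] by auto
          then have "head G e = v"
            using v h_eq[of "head G e" v] by (simp add: arcs_D)
          with e show "i \<in> (h \<circ> tail G) ` in_arcs D v"
            by force
        qed
      qed (auto simp: arcs_D)
    qed
    from sum.reindex_bij_betw[OF this, of "\<lambda>i. int (block_label i (h v))"]
    have incoming: "(\<Sum>e\<in>in_arcs D v. int (f e)) = (\<Sum>i<h v. int (block_label i (h v)))"
      \<comment> \<open>Transitivity with the reindexed sum leaves a termwise equality, which holds
        because every arc in \<open>in_arcs D v\<close> has head \<open>v\<close>.\<close>
      by (auto simp: f_def intro!: sum.cong elim: trans[rotated])
    have "bij_betw (h \<circ> head G) (out_arcs D v) {h v<..<n}"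
      unfolding bij_betw_def
    proof
      show "inj_on (h \<circ> head G) (out_arcs D v)"
        by (rule inj_onI) (auto simp: arcs_D intro: arc_eqI)
      show "(h \<circ> head G) ` out_arcs D v = {h v<..<n}"
      proof
        show "{h v<..<n} \<subseteq> (h \<circ> head G) ` out_arcs D v"
        proof
          fix j assume "j \<in> {h v<..<n}"
          then obtain e where e: "e \<in> arcs D" "h (tail G e) = h v" "h (head G e) = j"
            using arc_ex by auto
          then have "tail G e = v"
            using v h_eq[of "tail G e" v] by (simp add: arcs_D)
          with e show "j \<in> (h \<circ> head G) ` out_arcs D v"
            by force
        qed
      qed (auto simp: arcs_D h_less)
    qed
    from sum.reindex_bij_betw[OF this, of "\<lambda>j. int (block_label (h v) j)"]
    have "(\<Sum>e\<in>out_arcs D v. int (f e)) = (\<Sum>j\<in>{h v<..<n}. int (block_label (h v) j))"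
      by (auto simp: f_def intro!: sum.cong elim: trans[rotated])
    with incoming show ?thesis
      by (simp add: oriented_vertex_sum_def)
  qed
  have "inj_on (oriented_vertex_sum D f) (verts D)"
  proof (rule inj_onI)
    fix u v assume "u \<in> verts D" "v \<in> verts D"
      and "oriented_vertex_sum D f u = oriented_vertex_sum D f v"
    then show "u = v"
      using block_label_vertex_sum_less[of "h u" "h v" n]
        block_label_vertex_sum_less[of "h v" "h u" n]
      \<comment> \<open>If the numbers differ, one of the two strict inequalities contradicts equal
        sums; if they agree, injectivity of \<open>h\<close> gives \<open>u = v\<close>.\<close>
      by (cases "h u" "h v" rule: linorder_cases) (auto simp: vertex_sum h_less h_eq)
  qed
  with orientation bij show ?thesis
    unfolding antimagic_orientation_def antimagic_labeling_def by blast
qed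

end
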